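(* The language $A=\{ab^{i_1}ab^{i_2}\cdots ab^{i_k}\mid 0\le i_1\le i_2\le\dots\le i_k,\ k\in\mathbb N\}$ over the alphabet $\{a,b\}$ is EDT0L.
   Context: All alphabets are finite. A table over an alphabet $C$ is a finite subset $h\subseteq C\times C^*$; if $h$ contains no pair with first coordinate $c\in C$, then by convention the pair $(c,c)$ is taken to belong to $h$. For words $u=c_1\cdots c_m$ (with $c_j\in C$) and $v\in C^*$ write $u\longrightarrow^h v$ if $v=v_1\cdots v_m$ with $(c_j,v_j)\in h$ for every $j$ (parallel rewriting). For a word $r=h_1\cdots h_n$ over a set of tables, $u\longrightarrow^r v$ means there are words $u=u_0,u_1,\dots,u_n=v$ with $u_{j-1}\longrightarrow^{h_j}u_j$ for all $j$. A language $L\subseteq A_0^*$ is ET0L if there are an alphabet $C\supseteq A_0$, a finite set $H$ of tables over $C$, a regular language $\mathcal R\subseteq H^*$ and a letter $c\in C$ such that $L=\{w\in A_0^*\mid c\longrightarrow^r w\text{ for some }r\in\mathcal R\}$. It is EDT0L if this can be done with every table $h\in H$ deterministic, i.e. containing exactly one pair for each first coordinate in $C$ (so each $h$ is an endomorphism of $C^*$). *)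

theory Defs
  imports Main
begin

inductive_set regular :: "'h set \<Rightarrow> 'h list set set" for H :: "'h set" where
  empty: "{} \<in> regular H"
| epsilon: "{[]} \<in> regular H"
| letter: "h \<in> H \<Longrightarrow> {[h]} \<in> regular H"
| union: "K \<in> regular H \<Longrightarrow> L \<in> regular H \<Longrightarrow> K \<union> L \<in> regular H"
| conc: "K \<in> regular H \<Longrightarrow> L \<in> regular H \<Longrightarrow> {u @ v | u v. u \<in> K \<and> v \<in> L} \<in> regular H"
| star: "L \<in> regular H \<Longrightarrow> {concat ws | ws. set ws \<subseteq> L} \<in> regular H"

type_synonym 'c table = "('c \<times> 'c list) set"

definition is_table :: "'c set \<Rightarrow> 'c table \<Rightarrow> bool" where
  "is_table C h \<longleftrightarrow> finite h \<and> h \<subseteq> C \<times> lists C"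

text \<open>The convention that a letter without any rule in \<open>h\<close> is rewritten to itself.\<close>

definition completion :: "'c set \<Rightarrow> 'c table \<Rightarrow> 'c table" where
  "completion C h = h \<union> {(c, [c]) | c. c \<in> C \<and> (\<forall>v. (c, v) \<notin> h)}"

definition deterministic :: "'c set \<Rightarrow> 'c table \<Rightarrow> bool" where
  "deterministic C h \<longleftrightarrow> (\<forall>c\<in>C. \<exists>!v. (c, v) \<in> completion C h)"

definition rewrite_step :: "'c set \<Rightarrow> 'c table \<Rightarrow> 'c list \<Rightarrow> 'c list \<Rightarrow> bool" where
  "rewrite_step C h u v \<longleftrightarrow>
     (\<exists>vs. v = concat vs \<and> list_all2 (\<lambda>c w. (c, w) \<in> completion C h) u vs)"

fun derives :: "'c set \<Rightarrow> 'c table list \<Rightarrow> 'c list \<Rightarrow> 'c list \<Rightarrow> bool" where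
  "derives C [] u v \<longleftrightarrow> u = v"
| "derives C (h # r) u v \<longleftrightarrow> (\<exists>w. rewrite_step C h u w \<and> derives C r w v)"

text \<open>
  The extended alphabet \<open>C\<close> lives in the type \<open>'a + nat\<close>: \<open>Inl\<close> embeds the terminal
  alphabet \<open>A\<^sub>0\<close>, and \<open>Inr\<close> supplies arbitrarily many further letters even when \<open>'a\<close> is
  finite, so every finite extension of \<open>A\<^sub>0\<close> occurs up to renaming.
\<close>

definition ET0L_system ::
    "'a set \<Rightarrow> ('a + nat) set \<Rightarrow> ('a + nat) table set \<Rightarrow> ('a + nat) table list set \<Rightarrow> 'a + nat \<Rightarrow> bool"
  where
  "ET0L_system A\<^sub>0 C H R c \<longleftrightarrow>
     finite C \<and> Inl ` A\<^sub>0 \<subseteq> C \<and> finite H \<and> (\<forall>h\<in>H. is_table C h) \<and> R \<in> regular H \<and> c \<in> C"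

definition generated ::
    "'a set \<Rightarrow> ('a + nat) set \<Rightarrow> ('a + nat) table list set \<Rightarrow> 'a + nat \<Rightarrow> 'a list set" where
  "generated A\<^sub>0 C R c = {w \<in> lists A\<^sub>0. \<exists>r\<in>R. derives C r [c] (map Inl w)}"

definition ET0L :: "'a set \<Rightarrow> 'a list set \<Rightarrow> bool" where
  "ET0L A\<^sub>0 L \<longleftrightarrow> (\<exists>C H R c. ET0L_system A\<^sub>0 C H R c \<and> L = generated A\<^sub>0 C R c)"

definition EDT0L :: "'a set \<Rightarrow> 'a list set \<Rightarrow> bool" where
  "EDT0L A\<^sub>0 L \<longleftrightarrow>
     (\<exists>C H R c. ET0L_system A\<^sub>0 C H R c \<and> (\<forall>h\<in>H. deterministic C h) \<and> L = generated A\<^sub>0 C R c)"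

end

theory Submission
  imports Defs
begin

text \<open>
  A single auxiliary letter \<open>s\<close> suffices, together with three endomorphisms, each of which moves
  only one letter:
  \<open>s \<mapsto> s a\<close>, \<open>a \<mapsto> a b\<close> and \<open>s \<mapsto> \<epsilon>\<close>.
  Starting from \<open>s\<close>, the first one inserts a new block with exponent \<open>0\<close> in front of all existing
  blocks, and the second one raises the exponents of all existing blocks simultaneously.  A
  block further to the right is older, hence has been raised at least as often, so the exponents
  always form a sorted list (\<open>rewrite_sentential_form\<close>).  Conversely every sorted list of naturals
  arises from the empty list by prepending \<open>0\<close> and adding \<open>1\<close> to all entries
  (\<open>sorted_nat_induct\<close>), so every word of the language is reached.

  Every sequence of tables may be allowed as control.  A terminal word contains no \<open>s\<close>, so the
  erasing table has been applied; from then on \<open>s \<mapsto> s a\<close> and \<open>s \<mapsto> \<epsilon>\<close> act trivially, while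
  \<open>a \<mapsto> a b\<close> still preserves sortedness, so that a premature erasure does no harm.
\<close>

section \<open>Tables moving a single letter\<close>

definition subst :: "'c \<Rightarrow> 'c list \<Rightarrow> 'c list \<Rightarrow> 'c list" where
  "subst c x u = concat (map (\<lambda>d. if d = c then x else [d]) u)"

lemma subst_simps [simp]:
  "subst c x [] = []"
  "subst c x (d # u) = (if d = c then x else [d]) @ subst c x u"
  "subst c x (u @ v) = subst c x u @ subst c x v"
  by (simp_all add: subst_def)

lemma subst_absent: "c \<notin> set u \<Longrightarrow> subst c x u = u"
  by (induction u) auto

lemma in_completion_singleton:
  assumes "c \<in> C"
  shows "(d, w) \<in> completion C {(c, x)} \<longleftrightarrow> d \<in> C \<and> w = (if d = c then x else [d])"
  using assms by (auto simp: completion_def)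

lemma deterministic_singleton: "c \<in> C \<Longrightarrow> deterministic C {(c, x)}"
  by (simp add: deterministic_def in_completion_singleton)

lemma rewrite_step_singleton:
  assumes "c \<in> C"
  shows "rewrite_step C {(c, x)} u v \<longleftrightarrow> u \<in> lists C \<and> v = subst c x u"
proof -
  have "list_all2 (\<lambda>d w. (d, w) \<in> completion C {(c, x)}) u vs \<longleftrightarrow>
      u \<in> lists C \<and> vs = map (\<lambda>d. if d = c then x else [d]) u" for vs
    by (induction u arbitrary: vs) (auto simp: in_completion_singleton[OF assms] list_all2_Cons1)
  then show ?thesis
    by (auto simp: rewrite_step_def subst_def)
qed

section \<open>Derivations and unrestricted control\<close>

lemma derives_snoc:
  "derives C (r @ [h]) u v \<longleftrightarrow> (\<exists>w. derives C r u w \<and> rewrite_step C h w v)"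
  by (induction r arbitrary: u) auto

lemma derives_invariant:
  assumes "derives C r u v" and "r \<in> lists H" and "u \<in> I"
    and "\<And>h w w'. h \<in> H \<Longrightarrow> w \<in> I \<Longrightarrow> rewrite_step C h w w' \<Longrightarrow> w' \<in> I"
  shows "v \<in> I"
  using assms(1-3) by (induction r arbitrary: u) (auto dest: assms(4))

lemma regular_lists:
  assumes "finite H"
  shows "lists H \<in> regular H"
proof -
  have letters: "(\<lambda>h. [h]) ` K \<in> regular H" if "K \<subseteq> H" for K
    using finite_subset[OF that assms] that
  proof (induction K)
    case empty
    show ?case by (simp add: regular.empty)
  next
    case (insert h K)
    then show ?case
      using regular.union[OF regular.letter[of h H], of "(\<lambda>h. [h]) ` K"] by simp
  qed
  have "{concat ws | ws. set ws \<subseteq> (\<lambda>h. [h]) ` H} = lists H"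
  proof (intro equalityI subsetI)
    fix r assume "r \<in> lists H"
    then have "r = concat (map (\<lambda>h. [h]) r)" "set (map (\<lambda>h. [h]) r) \<subseteq> (\<lambda>h. [h]) ` H"
      by auto
    then show "r \<in> {concat ws | ws. set ws \<subseteq> (\<lambda>h. [h]) ` H}" by blast
  qed fastforce
  with regular.star[OF letters[OF subset_refl]] show ?thesis by simp
qed

section \<open>Sorted lists of exponents\<close>

text \<open>
  A sorted list starting with \<open>0\<close> is obtained by prepending \<open>0\<close> to a shorter one; in any other nonempty sorted list
  all entries are positive, so that \<open>1\<close> can be subtracted from each of them.
\<close>

lemma sorted_nat_induct [consumes 1, case_names Nil zero Suc]:
  fixes ns :: "nat list"
  assumes "sorted ns" and "P []"
    and "\<And>ns. sorted ns \<Longrightarrow> P ns \<Longrightarrow> P (0 # ns)"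
    and "\<And>ns. sorted ns \<Longrightarrow> P ns \<Longrightarrow> P (map Suc ns)"
  shows "P ns"
  using assms(1)
proof (induction "sum_list ns + length ns" arbitrary: ns rule: less_induct)
  case less
  show ?case
  proof (cases ns)
    case Nil
    then show ?thesis using assms(2) by simp
  next
    case (Cons n ms)
    show ?thesis
    proof (cases n)
      case 0
      then show ?thesis using less Cons assms(3)[of ms] by simp
    next
      case (Suc m)
      let ?ks = "map (\<lambda>i. i - 1) ns"
      have pos: "\<forall>i\<in>set ns. 0 < i" using less.prems Cons Suc by auto
      then have ns: "ns = map Suc ?ks" by (simp add: map_idI)
      have sorted: "sorted ?ks"
        by (rule sorted_map_mono[OF less.prems]) (simp add: monotone_on_def diff_le_mono)
      have "sum_list (map Suc ?ks) = sum_list ?ks + length ns"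
        by (simp only: sum_list_Suc length_map list.map_ident)
      with ns Cons have "sum_list ?ks + length ?ks < sum_list ns + length ns"
        by simp
      with less.hyps sorted have "P ?ks" by blast
      with assms(4)[OF sorted] ns show ?thesis by simp
    qed
  qed
qed

definition blocks :: "'c \<Rightarrow> 'c \<Rightarrow> nat list \<Rightarrow> 'c list" where
  "blocks a b ns = concat (map (\<lambda>i. a # replicate i b) ns)"

lemma blocks_simps [simp]:
  "blocks a b [] = []"
  "blocks a b (n # ns) = a # replicate n b @ blocks a b ns"
  by (simp_all add: blocks_def)

lemma set_blocks: "set (blocks a b ns) \<subseteq> {a, b}"
  by (induction ns) auto

lemma map_blocks: "map f (blocks a b ns) = blocks (f a) (f b) ns"
  by (induction ns) auto

lemma subst_grow_blocks:
  assumes "a \<noteq> b"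
  shows "subst a [a, b] (blocks a b ns) = blocks a b (map Suc ns)"
  using assms by (induction ns) (auto simp: subst_absent)

section \<open>The system\<close>

locale sorted_blocks =
  fixes a b s :: 'c
  assumes distinct: "a \<noteq> b" "s \<noteq> a" "s \<noteq> b"
begin

abbreviation letters :: "'c set" where
  "letters \<equiv> {a, b, s}"

abbreviation spawn :: "'c table" where
  "spawn \<equiv> {(s, [s, a])}"

abbreviation grow :: "'c table" where
  "grow \<equiv> {(a, [a, b])}"

abbreviation erase :: "'c table" where
  "erase \<equiv> {(s, [])}"

text \<open>
  An invariant containing all words derivable from \<open>s\<close>; the optional prefix \<open>[s]\<close> is the marker at
  which further blocks can be inserted.
\<close>

definition sentential_forms :: "'c list set" where
  "sentential_forms = {p @ blocks a b ns | p ns. p \<in> {[], [s]} \<and> sorted ns}"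

lemma blocks_in_lists: "blocks a b ns \<in> lists letters"
  using set_blocks[of a b ns] by auto

lemma subst_s_blocks: "subst s x (blocks a b ns) = blocks a b ns"
  using set_blocks[of a b ns] distinct by (intro subst_absent) auto

text \<open>
  Spawning puts the smallest possible exponent in front, growing is monotone on the exponents, and
  erasing only removes the marker \<open>s\<close>; without the marker, spawning and erasing change nothing.
\<close>

lemma rewrite_sentential_form:
  assumes "h \<in> {spawn, grow, erase}" and "u \<in> sentential_forms" and "rewrite_step letters h u v"
  shows "v \<in> sentential_forms"
proof -
  obtain p ns where u: "u = p @ blocks a b ns" and p: "p \<in> {[], [s]}" and ns: "sorted ns"
    using assms(2) by (auto simp: sentential_forms_def)
  consider (spawn) "v = subst s [s, a] u" | (grow) "v = subst a [a, b] u" | (erase) "v = subst s [] u"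
    using assms(1,3) by (auto simp: rewrite_step_singleton)
  then show ?thesis
  proof cases
    case spawn
    then have "v = [] @ blocks a b ns \<or> v = [s] @ blocks a b (0 # ns)"
      using u p by (auto simp: subst_s_blocks)
    moreover have "sorted (0 # ns)" using ns by simp
    ultimately show ?thesis using ns unfolding sentential_forms_def by blast
  next
    case grow
    then have "v = p @ blocks a b (map Suc ns)"
      using u p distinct by (auto simp: subst_grow_blocks)
    moreover have "sorted (map Suc ns)" using ns by (simp add: sorted_map)
    ultimately show ?thesis using p unfolding sentential_forms_def by blast
  next
    case erase
    then have "v = [] @ blocks a b ns"
      using u p by (auto simp: subst_s_blocks)
    then show ?thesis using ns unfolding sentential_forms_def by blast
  qed
qed

text \<open>
  The two steps of \<open>sorted_nat_induct\<close> are the effects of spawning and growing on the exponents.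
\<close>

lemma derives_marked_blocks:
  assumes "sorted ns"
  shows "\<exists>r\<in>lists {spawn, grow, erase}. derives letters r [s] (s # blocks a b ns)"
  using assms
proof (induction rule: sorted_nat_induct)
  case Nil
  show ?case by (rule bexI[of _ "[]"]) auto
next
  case (zero ns)
  then obtain r where r: "r \<in> lists {spawn, grow, erase}"
      "derives letters r [s] (s # blocks a b ns)" by blast
  have "rewrite_step letters spawn (s # blocks a b ns) (s # blocks a b (0 # ns))"
    using blocks_in_lists by (simp add: rewrite_step_singleton subst_s_blocks)
  with r have "derives letters (r @ [spawn]) [s] (s # blocks a b (0 # ns))"
    unfolding derives_snoc by blast
  moreover have "r @ [spawn] \<in> lists {spawn, grow, erase}" using r(1) by simp
  ultimately show ?case by blast
next
  case (Suc ns)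
  then obtain r where r: "r \<in> lists {spawn, grow, erase}"
      "derives letters r [s] (s # blocks a b ns)" by blast
  have "rewrite_step letters grow (s # blocks a b ns) (s # blocks a b (map Suc ns))"
    using blocks_in_lists distinct by (simp add: rewrite_step_singleton subst_grow_blocks)
  with r have "derives letters (r @ [grow]) [s] (s # blocks a b (map Suc ns))"
    unfolding derives_snoc by blast
  moreover have "r @ [grow] \<in> lists {spawn, grow, erase}" using r(1) by simp
  ultimately show ?case by blast
qed

lemma derivable_unmarked_iff:
  assumes "s \<notin> set v"
  shows "(\<exists>r\<in>lists {spawn, grow, erase}. derives letters r [s] v) \<longleftrightarrow>
    (\<exists>ns. sorted ns \<and> v = blocks a b ns)"
proof
  assume "\<exists>r\<in>lists {spawn, grow, erase}. derives letters r [s] v"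
  then obtain r where r: "r \<in> lists {spawn, grow, erase}" "derives letters r [s] v" by blast
  have "[s] = [s] @ blocks a b [] \<and> sorted ([] :: nat list)" by simp
  then have "[s] \<in> sentential_forms" unfolding sentential_forms_def by blast
  from derives_invariant[OF r(2,1) this rewrite_sentential_form]
  have "v \<in> sentential_forms" .
  with assms show "\<exists>ns. sorted ns \<and> v = blocks a b ns"
    by (auto simp: sentential_forms_def)
next
  assume "\<exists>ns. sorted ns \<and> v = blocks a b ns"
  then obtain ns where ns: "sorted ns" and v: "v = blocks a b ns" by blast
  obtain r where r: "r \<in> lists {spawn, grow, erase}" "derives letters r [s] (s # blocks a b ns)"
    using derives_marked_blocks[OF ns] by blast
  have "rewrite_step letters erase (s # blocks a b ns) v"
    using blocks_in_lists by (simp add: rewrite_step_singleton subst_s_blocks v)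
  with r have "derives letters (r @ [erase]) [s] v"
    unfolding derives_snoc by blast
  moreover have "r @ [erase] \<in> lists {spawn, grow, erase}" using r(1) by simp
  ultimately show "\<exists>r\<in>lists {spawn, grow, erase}. derives letters r [s] v" by blast
qed

end

theorem proposition7:
  fixes a b :: 'a
  assumes "a \<noteq> b"
  shows "EDT0L {a, b} {concat (map (\<lambda>i. a # replicate i b) ns) | ns :: nat list. sorted ns}"
proof -
  interpret sorted_blocks "Inl a :: 'a + nat" "Inl b" "Inr 0"
    using assms by unfold_locales auto
  let ?H = "{spawn, grow, erase}"
  have system: "ET0L_system {a, b} letters ?H (lists ?H) (Inr 0)"
    by (simp add: ET0L_system_def is_table_def regular_lists)
  have deterministic: "\<forall>h\<in>?H. deterministic letters h"
    by (simp add: deterministic_singleton)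
  have "w \<in> generated {a, b} letters (lists ?H) (Inr 0) \<longleftrightarrow>
      (\<exists>ns. sorted ns \<and> w = blocks a b ns)" for w
  proof -
    have "Inr 0 \<notin> set (map Inl w :: ('a + nat) list)" by auto
    then have "w \<in> generated {a, b} letters (lists ?H) (Inr 0) \<longleftrightarrow>
        w \<in> lists {a, b} \<and> (\<exists>ns. sorted ns \<and> map (Inl :: 'a \<Rightarrow> 'a + nat) w = map Inl (blocks a b ns))"
      by (simp only: generated_def mem_Collect_eq derivable_unmarked_iff[OF \<open>Inr 0 \<notin> _\<close>] map_blocks)
    also have "\<dots> \<longleftrightarrow> (\<exists>ns. sorted ns \<and> w = blocks a b ns)"
      using set_blocks[of a b] by (fastforce simp: inj_map_eq_map)
    finally show ?thesis .
  qed
  then have "{concat (map (\<lambda>i. a # replicate i b) ns) | ns. sorted ns} =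
      generated {a, b} letters (lists ?H) (Inr 0)"
    unfolding blocks_def by blast
  with system deterministic show ?thesis
    unfolding EDT0L_def by blast
qed

end
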